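(* Let $\lambda\in\mathbb C$. The Verma $\mathfrak{sl}(2)$-module $M(\lambda)$ admits exactly one compatible structure of $\mathbf{Witt}_{>}$-module. The structure is explicitly given, for $i\ge-1$ and $j\ge0$, by $$\rho_{>}^{-}(L_i)w_j=\Big(-\tfrac12\big(2(i-j)+(i+1)\lambda\big)\,P(j-i+1,i)\Big)w_{j-i}\qquad\text{if } j-i\ge0,$$ and $\rho_{>}^{-}(L_i)w_j=0$ if $j-i<0$. With respect to $\rho_{>}^{-}$, $M(\lambda)$ is a highest weight $\mathbf{Witt}_{>}$-module and $-\frac12\lambda$ is the highest weight.
   Context: $\mathfrak{sl}(2)=\mathfrak{sl}(2,\mathbb C)$ has Chevalley basis $\{e,f,h\}$ with $[e,f]=h$, $[h,e]=2e$, $[h,f]=-2f$. $\mathbf{Witt}_{>}$ is the complex Lie algebra with basis $\{L_k\}_{k\ge-1}$ and bracket $[L_i,L_j]=(i-j)L_{i+j}$; $\mathfrak{sl}(2)$ is embedded in it by $f\mapsto L_{-1}$, $h\mapsto-2L_0$, $e\mapsto-L_1$, and a $\mathbf{Witt}_{>}$-module structure on an $\mathfrak{sl}(2)$-module is compatible if its restriction along this embedding is the given $\mathfrak{sl}(2)$-structure. $M(\lambda)$ is the vector space with basis $\{w_j: j=0,1,2,\dots\}$ and action $f w_j=w_{j+1}$, $h w_j=(\lambda-2j)w_j$, $e w_j=j(\lambda-j+1)w_{j-1}$ for $j\neq0$, $e w_0=0$. The Pochhammer symbol is $P(z,n)=z(z+1)\cdots(z+n-1)$ for $n\ge0$ and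 $P(z,n)=\frac1{(z+n)\cdots(z-1)}$ for $n\le-1$. A highest weight $\mathbf{Witt}_{>}$-module of highest weight $a$ is one generated by a nonzero vector $v$ with $L_0v=av$ and $L_iv=0$ for all $i>0$. *)

theory Defs
  imports "HOL-Analysis.Analysis" "HOL-Library.Poly_Mapping"
begin

section \<open>Lie algebras and their modules\<close>

locale lie_algebra = vector_space scale
  for scale :: "'k::field \<Rightarrow> 'g::ab_group_add \<Rightarrow> 'g" +
  fixes bracket :: "'g \<Rightarrow> 'g \<Rightarrow> 'g"
  assumes bracket_add_left: "bracket (x + y) z = bracket x z + bracket y z"
    and bracket_add_right: "bracket x (y + z) = bracket x y + bracket x z"
    and bracket_scale_left: "bracket (scale c x) y = scale c (bracket x y)"
    and bracket_scale_right: "bracket x (scale c y) = scale c (bracket x y)"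
    and bracket_self: "bracket x x = 0"
    and jacobi: "bracket x (bracket y z) + bracket y (bracket z x) + bracket z (bracket x y) = 0"

locale lie_module = lie_algebra scale bracket + V: vector_space vscale
  for scale :: "'k::field \<Rightarrow> 'g::ab_group_add \<Rightarrow> 'g"
    and bracket :: "'g \<Rightarrow> 'g \<Rightarrow> 'g"
    and vscale :: "'k \<Rightarrow> 'v::ab_group_add \<Rightarrow> 'v" +
  fixes act :: "'g \<Rightarrow> 'v \<Rightarrow> 'v"
  assumes act_add_left: "act (x + y) v = act x v + act y v"
    and act_scale_left: "act (scale c x) v = vscale c (act x v)"
    and act_add_right: "act x (v + w) = act x v + act x w"
    and act_scale_right: "act x (vscale c v) = vscale c (act x v)"
    and act_bracket: "act (bracket x y) v = act x (act y v) - act y (act x v)"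
begin

definition submodule :: "'v set \<Rightarrow> bool" where
  "submodule U \<longleftrightarrow> V.subspace U \<and> (\<forall>x. \<forall>u\<in>U. act x u \<in> U)"

definition generated_submodule :: "'v set \<Rightarrow> 'v set" where
  "generated_submodule S = \<Inter>{U. submodule U \<and> S \<subseteq> U}"

end


section \<open>Free complex vector spaces\<close>

text \<open>Finitely supported functions \<^typ>\<open>'a \<Rightarrow>\<^sub>0 complex\<close> form the complex vector space
  with basis the vectors \<open>Poly_Mapping.single i 1\<close>.\<close>

definition fscale :: "complex \<Rightarrow> ('a \<Rightarrow>\<^sub>0 complex) \<Rightarrow> ('a \<Rightarrow>\<^sub>0 complex)" where
  "fscale c = Poly_Mapping.map ((*) c)"

lemma lookup_fscale [simp]: "Poly_Mapping.lookup (fscale c x) i = c * Poly_Mapping.lookup x i"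
  unfolding fscale_def by transfer (simp add: when_def)

lemma fscale_add: "fscale c (x + y) = fscale c x + fscale c y"
  and fscale_add_left: "fscale (c + d) x = fscale c x + fscale d x"
  and fscale_fscale [simp]: "fscale c (fscale d x) = fscale (c * d) x"
  and fscale_one [simp]: "fscale 1 x = x"
  and fscale_zero [simp]: "fscale 0 x = 0" "fscale c 0 = 0"
  and fscale_single [simp]: "fscale c (Poly_Mapping.single i a) = Poly_Mapping.single i (c * a)"
  by (rule poly_mapping_eqI; simp add: lookup_add algebra_simps lookup_single when_def)+

lemma keys_fscale: "Poly_Mapping.keys (fscale c x) \<subseteq> Poly_Mapping.keys x"
  by (auto simp: in_keys_iff)

lemma vector_space_fscale: "vector_space fscale"
  by unfold_locales (simp_all add: fscale_add fscale_add_left)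

definition lin_ext :: "('a \<Rightarrow> ('b \<Rightarrow>\<^sub>0 complex)) \<Rightarrow> ('a \<Rightarrow>\<^sub>0 complex) \<Rightarrow> ('b \<Rightarrow>\<^sub>0 complex)" where
  "lin_ext g x = (\<Sum>i\<in>Poly_Mapping.keys x. fscale (Poly_Mapping.lookup x i) (g i))"

lemma lin_ext_superset:
  assumes "finite A" "Poly_Mapping.keys x \<subseteq> A"
  shows "lin_ext g x = (\<Sum>i\<in>A. fscale (Poly_Mapping.lookup x i) (g i))"
  unfolding lin_ext_def using assms
  by (intro sum.mono_neutral_left) (auto simp: in_keys_iff)

lemma lin_ext_add: "lin_ext g (x + y) = lin_ext g x + lin_ext g y"
proof -
  let ?A = "Poly_Mapping.keys x \<union> Poly_Mapping.keys y"
  have "Poly_Mapping.keys (x + y) \<subseteq> ?A"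
    by (rule keys_add)
  then show ?thesis
    using lin_ext_superset[of ?A x g] lin_ext_superset[of ?A y g] lin_ext_superset[of ?A "x + y" g]
    by (simp add: lookup_add fscale_add_left sum.distrib)
qed

lemma lin_ext_fscale: "lin_ext g (fscale c x) = fscale c (lin_ext g x)"
proof -
  interpret vector_space fscale by (rule vector_space_fscale)
  show ?thesis
    using keys_fscale[of c x] lin_ext_superset[of "Poly_Mapping.keys x" "fscale c x" g] lin_ext_superset[of "Poly_Mapping.keys x" x g]
    by (simp add: scale_sum_right)
qed

lemma lin_ext_single [simp]: "lin_ext g (Poly_Mapping.single i a) = fscale a (g i)"
  by (simp add: lin_ext_def)

lemma lin_ext_zero [simp]: "lin_ext g 0 = 0"
  by (simp add: lin_ext_def)

lemma free_induct [case_names single add]: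
  assumes "\<And>i a. P (Poly_Mapping.single i a)" "\<And>x y. P x \<Longrightarrow> P y \<Longrightarrow> P (x + y)"
  shows "P (x :: 'a \<Rightarrow>\<^sub>0 complex)"
proof (induction x rule: update_induct)
  case const
  show ?case using assms(1)[of undefined 0] by simp
next
  case (update f a b)
  have "Poly_Mapping.update a b f = f + Poly_Mapping.single a b"
    using update(1)
    by (intro poly_mapping_eqI)
      (auto simp: lookup_update lookup_add lookup_single when_def in_keys_iff)
  then show ?case using assms update by simp
qed


section \<open>The Lie algebra \<open>sl(2)\<close>\<close>

typedef sl2 = "{A :: complex^2^2. trace A = 0}"
  by (rule exI[of _ 0]) (simp add: trace_def)

setup_lifting type_definition_sl2

instantiation sl2 :: ab_group_add
begin
lift_definition zero_sl2 :: sl2 is 0 by (simp add: trace_def)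
lift_definition plus_sl2 :: "sl2 \<Rightarrow> sl2 \<Rightarrow> sl2" is "(+)" by (simp add: trace_add)
lift_definition minus_sl2 :: "sl2 \<Rightarrow> sl2 \<Rightarrow> sl2" is "(-)" by (simp add: trace_sub)
lift_definition uminus_sl2 :: "sl2 \<Rightarrow> sl2" is uminus by (simp add: trace_def sum_negf)
instance by standard (transfer; simp)+
end

lift_definition sl2_scale :: "complex \<Rightarrow> sl2 \<Rightarrow> sl2" is "\<lambda>c A. \<chi> i j. c * A $ i $ j"
  by (simp add: trace_def sum_2 flip: distrib_left)

lift_definition sl2_bracket :: "sl2 \<Rightarrow> sl2 \<Rightarrow> sl2" is "\<lambda>A B. A ** B - B ** A"
proof -
  fix A B :: "complex^2^2"
  show "trace (A ** B - B ** A) = 0"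
    using trace_mul_sym[of A B] by (simp add: trace_sub)
qed

lift_definition sl2_entry :: "sl2 \<Rightarrow> 2 \<Rightarrow> 2 \<Rightarrow> complex" is "\<lambda>A i j. A $ i $ j" .

lift_definition sl2_e :: sl2 is "vector [vector [0, 1], vector [0, 0]]"
  by (simp add: trace_def sum_2)

lift_definition sl2_f :: sl2 is "vector [vector [0, 0], vector [1, 0]]"
  by (simp add: trace_def sum_2)

lift_definition sl2_h :: sl2 is "vector [vector [1, 0], vector [0, -1]]"
  by (simp add: trace_def sum_2)

lemma sl2_lie_algebra: "lie_algebra sl2_scale sl2_bracket"
  by unfold_locales
    (transfer; simp add: vec_eq_iff forall_2 sum_2 matrix_matrix_mult_def algebra_simps)+

lemma sl2_chevalley:
  "sl2_bracket sl2_e sl2_f = sl2_h"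
  "sl2_bracket sl2_h sl2_e = sl2_scale 2 sl2_e"
  "sl2_bracket sl2_h sl2_f = sl2_scale (-2) sl2_f"
  by (transfer; simp add: vec_eq_iff forall_2 sum_2 matrix_matrix_mult_def)+

lemma sl2_entry_bracket:
  "sl2_entry (sl2_bracket x y) 1 1 =
     sl2_entry x 1 2 * sl2_entry y 2 1 - sl2_entry x 2 1 * sl2_entry y 1 2"
  "sl2_entry (sl2_bracket x y) 1 2 =
     2 * (sl2_entry x 1 1 * sl2_entry y 1 2 - sl2_entry x 1 2 * sl2_entry y 1 1)"
  "sl2_entry (sl2_bracket x y) 2 1 =
     2 * (sl2_entry x 2 1 * sl2_entry y 1 1 - sl2_entry x 1 1 * sl2_entry y 2 1)"
  by (transfer; simp add: matrix_matrix_mult_def sum_2 trace_def add_eq_0_iff algebra_simps)+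

lemma sl2_decomp:
  "x = sl2_scale (sl2_entry x 1 2) sl2_e + sl2_scale (sl2_entry x 1 1) sl2_h
     + sl2_scale (sl2_entry x 2 1) sl2_f"
  by transfer (simp add: vec_eq_iff forall_2 trace_def sum_2 add_eq_0_iff)


section \<open>The Lie algebra \<open>Witt\<^sub>>\<close>\<close>

definition full_witt_bracket :: "(int \<Rightarrow>\<^sub>0 complex) \<Rightarrow> (int \<Rightarrow>\<^sub>0 complex) \<Rightarrow> (int \<Rightarrow>\<^sub>0 complex)" where
  "full_witt_bracket x y =
     lin_ext (\<lambda>i. lin_ext (\<lambda>j. Poly_Mapping.single (i + j) (of_int (i - j))) y) x"

lemma full_witt_bracket_single:
  "full_witt_bracket (Poly_Mapping.single i a) (Poly_Mapping.single j b) =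
     Poly_Mapping.single (i + j) (a * b * of_int (i - j))"
  by (simp add: full_witt_bracket_def mult.assoc)

lemma full_witt_bracket_add_left:
  "full_witt_bracket (x + y) z = full_witt_bracket x z + full_witt_bracket y z"
  by (simp add: full_witt_bracket_def lin_ext_add)

lemma full_witt_bracket_anticomm: "full_witt_bracket x y = - full_witt_bracket y x"
proof -
  have add_right: "full_witt_bracket u (v + w) = full_witt_bracket u v + full_witt_bracket u w"
    for u v w
    by (induction u rule: free_induct)
      (simp_all add: full_witt_bracket_def lin_ext_add fscale_add algebra_simps)
  show ?thesis
  proof (induction x rule: free_induct)
    case (single i a)
    show ?case
    proof (induction y rule: free_induct)
      case (single j b)
      show ?case
        by (simp add: full_witt_bracket_single single_uminus[symmetric] algebra_simps)
    next
      case (add y z)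
      then show ?case by (simp add: add_right full_witt_bracket_add_left)
    qed
  next
    case (add x z)
    then show ?case by (simp add: add_right full_witt_bracket_add_left)
  qed
qed

lemma full_witt_bracket_add_right:
  "full_witt_bracket x (y + z) = full_witt_bracket x y + full_witt_bracket x z"
  using full_witt_bracket_anticomm[of x] by (simp add: full_witt_bracket_add_left)

lemma fscale_uminus: "fscale c (- x) = - fscale c x"
  by (rule poly_mapping_eqI) simp

lemma full_witt_bracket_scale_left:
  "full_witt_bracket (fscale c x) y = fscale c (full_witt_bracket x y)"
  by (simp add: full_witt_bracket_def lin_ext_fscale)

lemma full_witt_bracket_scale_right:
  "full_witt_bracket x (fscale c y) = fscale c (full_witt_bracket x y)"
  using full_witt_bracket_anticomm[of x] by (simp add: full_witt_bracket_scale_left fscale_uminus)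

lemma full_witt_bracket_self: "full_witt_bracket x x = 0"
proof (rule poly_mapping_eqI)
  fix k
  have "Poly_Mapping.lookup (full_witt_bracket x x) k = - Poly_Mapping.lookup (full_witt_bracket x x) k"
    using full_witt_bracket_anticomm[of x x] lookup_uminus by metis
  then show "Poly_Mapping.lookup (full_witt_bracket x x) k = Poly_Mapping.lookup 0 k" by simp
qed

lemma full_witt_jacobi:
  "full_witt_bracket x (full_witt_bracket y z) + full_witt_bracket y (full_witt_bracket z x)
     + full_witt_bracket z (full_witt_bracket x y) = 0"
proof (induction x rule: free_induct)
  case (single i a)
  show ?case
  proof (induction y rule: free_induct)
    case (single j b)
    show ?case
    proof (induction z rule: free_induct)
      case (single k c)
      show ?case
        by (rule poly_mapping_eqI)
          (simp add: full_witt_bracket_single lookup_add lookup_single when_def algebra_simps)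
    next
      case (add z z')
      from arg_cong2[OF add, of "(+)"] show ?case
        by (simp add: full_witt_bracket_add_left full_witt_bracket_add_right add_ac)
    qed
  next
    case (add y y')
    from arg_cong2[OF add, of "(+)"] show ?case
        by (simp add: full_witt_bracket_add_left full_witt_bracket_add_right add_ac)
  qed
next
  case (add x x')
  from arg_cong2[OF add, of "(+)"] show ?case
        by (simp add: full_witt_bracket_add_left full_witt_bracket_add_right add_ac)
qed

typedef witt = "{x :: int \<Rightarrow>\<^sub>0 complex. Poly_Mapping.keys x \<subseteq> {-1..}}"
  by (rule exI[of _ 0]) simp

setup_lifting type_definition_witt

instantiation witt :: ab_group_add
begin
lift_definition zero_witt :: witt is 0 by simp
lift_definition plus_witt :: "witt \<Rightarrow> witt \<Rightarrow> witt" is "(+)"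
  by (rule order_trans[OF keys_add]) simp
lift_definition uminus_witt :: "witt \<Rightarrow> witt" is uminus
  by (simp only: keys_minus)
lift_definition minus_witt :: "witt \<Rightarrow> witt \<Rightarrow> witt" is "(-)"
  by (rule order_trans[OF keys_diff]) simp
instance by standard (transfer; simp add: add.assoc add.commute)+
end

lift_definition witt_scale :: "complex \<Rightarrow> witt \<Rightarrow> witt" is fscale
  by (rule order_trans[OF keys_fscale])

lift_definition witt_bracket :: "witt \<Rightarrow> witt \<Rightarrow> witt" is full_witt_bracket
proof -
  fix x y :: "int \<Rightarrow>\<^sub>0 complex"
  assume x: "Poly_Mapping.keys x \<subseteq> {-1..}" and y: "Poly_Mapping.keys y \<subseteq> {-1..}"
  have "Poly_Mapping.lookup (full_witt_bracket x y) k = 0" if "k < -1" for k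
  proof -
    have "Poly_Mapping.lookup x i * (Poly_Mapping.lookup y j * Poly_Mapping.lookup (Poly_Mapping.single (i + j) (of_int (i - j))) k) = (0::complex)"
      if "i \<in> Poly_Mapping.keys x" "j \<in> Poly_Mapping.keys y" for i j
    proof -
      have "i \<ge> -1" "j \<ge> -1" using that x y by auto
      then have "i + j \<noteq> k \<or> i - j = 0" using \<open>k < -1\<close> by linarith
      then show ?thesis
      proof
        assume "i + j \<noteq> k"
        then show ?thesis by (simp add: lookup_single)
      next
        assume "i - j = 0"
        then show ?thesis by simp
      qed
    qed
    then show ?thesis
      unfolding full_witt_bracket_def lin_ext_def lookup_sum lookup_fscale sum_distrib_left
      by (intro sum.neutral ballI)
  qed
  then show "Poly_Mapping.keys (full_witt_bracket x y) \<subseteq> {-1..}"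
    by (meson atLeast_iff in_keys_iff not_less subsetI)
qed

text \<open>The basis vector \<open>L\<^sub>k\<close>; only indices \<open>k \<ge> -1\<close> are meaningful.\<close>

lift_definition L :: "int \<Rightarrow> witt" is "\<lambda>k. if k \<ge> -1 then Poly_Mapping.single k 1 else 0"
  by simp

lemma witt_lie_algebra: "lie_algebra witt_scale witt_bracket"
  by unfold_locales
    (transfer; simp add: fscale_add fscale_add_left full_witt_bracket_add_left
      full_witt_bracket_add_right full_witt_bracket_scale_left full_witt_bracket_scale_right
      full_witt_bracket_self full_witt_jacobi)+

lemma witt_bracket_L:
  assumes "i \<ge> -1" "j \<ge> -1"
  shows "witt_bracket (L i) (L j) = witt_scale (of_int (i - j)) (L (i + j))"
  using assms
  by transfer (auto simp: full_witt_bracket_single intro!: poly_mapping_eqI simp: lookup_single when_def)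


section \<open>Compatible \<open>Witt\<^sub>>\<close>-module structures\<close>

text \<open>The linear map with \<open>f \<mapsto> L\<^sub>-\<^sub>1\<close>, \<open>h \<mapsto> -2 L\<^sub>0\<close>, \<open>e \<mapsto> -L\<^sub>1\<close>, written in matrix coordinates.\<close>

definition sl2_to_witt :: "sl2 \<Rightarrow> witt" where
  "sl2_to_witt x = witt_scale (sl2_entry x 1 2) (- L 1)
     + witt_scale (sl2_entry x 1 1) (witt_scale (-2) (L 0))
     + witt_scale (sl2_entry x 2 1) (L (-1))"

lemma sl2_to_witt_chevalley:
  "sl2_to_witt sl2_f = L (-1)"
  "sl2_to_witt sl2_h = witt_scale (-2) (L 0)"
  "sl2_to_witt sl2_e = - L 1"
  unfolding sl2_to_witt_def by (transfer; simp)+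

lemma sl2_to_witt_bracket:
  "sl2_to_witt (sl2_bracket x y) = witt_bracket (sl2_to_witt x) (sl2_to_witt y)"
proof -
  interpret W: lie_algebra witt_scale witt_bracket by (rule witt_lie_algebra)
  have expand: "sl2_to_witt x = witt_scale (- sl2_entry x 1 2) (L 1)
      + witt_scale (-2 * sl2_entry x 1 1) (L 0) + witt_scale (sl2_entry x 2 1) (L (-1))" for x
    by (simp add: sl2_to_witt_def mult.commute)
  have basis: "witt_bracket (L 1) (L 0) = L 1" "witt_bracket (L 0) (L 1) = witt_scale (-1) (L 1)"
    "witt_bracket (L 1) (L (-1)) = witt_scale 2 (L 0)"
    "witt_bracket (L (-1)) (L 1) = witt_scale (-2) (L 0)"
    "witt_bracket (L 0) (L (-1)) = L (-1)" "witt_bracket (L (-1)) (L 0) = witt_scale (-1) (L (-1))"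
    using witt_bracket_L[of 1 0] witt_bracket_L[of 0 1] witt_bracket_L[of 1 "-1"]
      witt_bracket_L[of "-1" 1] witt_bracket_L[of 0 "-1"] witt_bracket_L[of "-1" 0]
    by simp_all
  have scale_diff: "witt_scale (r - r') u = witt_scale r u + witt_scale (- r') u" for r r' u
    by (simp add: W.scale_left_diff_distrib)
  have bilin: "witt_bracket (witt_scale a (L 1) + witt_scale b (L 0) + witt_scale c (L (-1)))
      (witt_scale a' (L 1) + witt_scale b' (L 0) + witt_scale c' (L (-1)))
    = witt_scale (a * b' - b * a') (L 1) + witt_scale (2 * a * c' - 2 * c * a') (L 0)
      + witt_scale (b * c' - c * b') (L (-1))" for a b c a' b' c'
    by (simp only: W.bracket_add_left W.bracket_add_right W.bracket_scale_left
        W.bracket_scale_right W.bracket_self basis W.scale_scale W.scale_zero_right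
        scale_diff add_0_left add_0_right mult_minus_right mult_minus_left mult_1_right
        mult_1_left W.scale_right_distrib ac_simps)
  show ?thesis
    unfolding expand sl2_entry_bracket bilin by (simp add: algebra_simps)
qed

abbreviation witt_module ::
    "(complex \<Rightarrow> 'v \<Rightarrow> 'v) \<Rightarrow> (witt \<Rightarrow> 'v \<Rightarrow> 'v::ab_group_add) \<Rightarrow> bool" where
  "witt_module \<equiv> lie_module witt_scale witt_bracket"

definition compatible_witt_module ::
    "(complex \<Rightarrow> 'v \<Rightarrow> 'v) \<Rightarrow> (sl2 \<Rightarrow> 'v \<Rightarrow> 'v) \<Rightarrow> (witt \<Rightarrow> 'v \<Rightarrow> 'v::ab_group_add) \<Rightarrow> bool" where
  "compatible_witt_module vscale \<sigma> \<rho> \<longleftrightarrow>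
     witt_module vscale \<rho> \<and> (\<forall>x v. \<rho> (sl2_to_witt x) v = \<sigma> x v)"

definition highest_weight_witt_module ::
    "(complex \<Rightarrow> 'v \<Rightarrow> 'v) \<Rightarrow> (witt \<Rightarrow> 'v \<Rightarrow> 'v::ab_group_add) \<Rightarrow> complex \<Rightarrow> bool" where
  "highest_weight_witt_module vscale \<rho> a \<longleftrightarrow>
     witt_module vscale \<rho> \<and>
     (\<exists>v. v \<noteq> 0 \<and> \<rho> (L 0) v = vscale a v \<and> (\<forall>i>0. \<rho> (L i) v = 0) \<and>
       lie_module.generated_submodule vscale \<rho> {v} = UNIV)"


section \<open>The Verma module \<open>M(\<lambda>)\<close>\<close>

type_synonym verma = "nat \<Rightarrow>\<^sub>0 complex"

definition w :: "nat \<Rightarrow> verma" where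
  "w j = Poly_Mapping.single j 1"

definition verma_f :: "verma \<Rightarrow> verma" where
  "verma_f = lin_ext (\<lambda>j. w (j + 1))"

definition verma_h :: "complex \<Rightarrow> verma \<Rightarrow> verma" where
  "verma_h lam = lin_ext (\<lambda>j. fscale (lam - 2 * of_nat j) (w j))"

definition verma_e :: "complex \<Rightarrow> verma \<Rightarrow> verma" where
  "verma_e lam = lin_ext (\<lambda>j. if j = 0 then 0
     else fscale (of_nat j * (lam - of_nat j + 1)) (w (j - 1)))"

definition verma_action :: "complex \<Rightarrow> sl2 \<Rightarrow> verma \<Rightarrow> verma" where
  "verma_action lam x v = fscale (sl2_entry x 1 2) (verma_e lam v)
     + fscale (sl2_entry x 1 1) (verma_h lam v) + fscale (sl2_entry x 2 1) (verma_f v)"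

lemma verma_action_basis:
  "verma_action lam sl2_f (w j) = w (j + 1)"
  "verma_action lam sl2_h (w j) = fscale (lam - 2 * of_nat j) (w j)"
  "j \<noteq> 0 \<Longrightarrow> verma_action lam sl2_e (w j) = fscale (of_nat j * (lam - of_nat j + 1)) (w (j - 1))"
  "verma_action lam sl2_e (w 0) = 0"
  by (simp_all add: verma_action_def verma_f_def verma_h_def verma_e_def w_def sl2_entry.rep_eq
      sl2_e.rep_eq sl2_f.rep_eq sl2_h.rep_eq del: single_one)

lemma verma_sl2_module: "lie_module sl2_scale sl2_bracket fscale (verma_action lam)"
proof -
  have lin: "verma_e lam (x + y) = verma_e lam x + verma_e lam y"
    "verma_h lam (x + y) = verma_h lam x + verma_h lam y"
    "verma_f (x + y) = verma_f x + verma_f y"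
    "verma_e lam (fscale c x) = fscale c (verma_e lam x)"
    "verma_h lam (fscale c x) = fscale c (verma_h lam x)"
    "verma_f (fscale c x) = fscale c (verma_f x)" for x y c
    by (simp_all add: verma_e_def verma_h_def verma_f_def lin_ext_add lin_ext_fscale)
  have he: "verma_h lam (verma_e lam v) = verma_e lam (verma_h lam v) + fscale 2 (verma_e lam v)" for v
  proof (induction v rule: free_induct)
    case (single i a)
    show ?case
      by (cases i; rule poly_mapping_eqI;
          simp add: verma_e_def verma_h_def verma_f_def w_def lookup_add lookup_single when_def
            del: single_one; simp add: algebra_simps)
  next
    case (add x y)
    then show ?case by (simp add: lin fscale_add algebra_simps)
  qed
  have hf: "verma_h lam (verma_f v) = verma_f (verma_h lam v) + fscale (-2) (verma_f v)" for v
  proof (induction v rule: free_induct)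
    case (single i a)
    show ?case
      by (cases i; rule poly_mapping_eqI;
          simp add: verma_e_def verma_h_def verma_f_def w_def lookup_add lookup_single when_def
            del: single_one; simp add: algebra_simps)
  next
    case (add x y)
    then show ?case by (simp add: lin fscale_add algebra_simps)
  qed
  have ef: "verma_e lam (verma_f v) = verma_f (verma_e lam v) + verma_h lam v" for v
  proof (induction v rule: free_induct)
    case (single i a)
    show ?case
      by (cases i; rule poly_mapping_eqI;
          simp add: verma_e_def verma_h_def verma_f_def w_def lookup_add lookup_single when_def
            del: single_one; simp add: algebra_simps)
  next
    case (add x y)
    then show ?case by (simp add: lin fscale_add algebra_simps)
  qed
  have ent: "sl2_entry (x + y) i j = sl2_entry x i j + sl2_entry y i j"
    "sl2_entry (sl2_scale c x) i j = c * sl2_entry x i j" for x y c i j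
    by (transfer; simp)+
  show ?thesis
    apply (intro lie_module.intro lie_module_axioms.intro)
    subgoal by (rule sl2_lie_algebra)
    subgoal by (rule vector_space_fscale)
    subgoal by (simp add: verma_action_def ent fscale_add_left algebra_simps)
    subgoal by (simp add: verma_action_def ent fscale_add algebra_simps)
    subgoal by (simp add: verma_action_def lin fscale_add algebra_simps)
    subgoal by (simp add: verma_action_def lin fscale_add algebra_simps)
    subgoal by (rule poly_mapping_eqI) (simp add: verma_action_def sl2_entry_bracket lin he hf ef lookup_add lookup_minus fscale_add algebra_simps)
    done
qed

text \<open>Pochhammer symbol with an integer second argument:
  \<open>P z n = z (z + 1) \<dots> (z + n - 1)\<close> for \<open>n \<ge> 0\<close>, and \<open>P z n = 1 / ((z + n) \<dots> (z - 1))\<close>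
  for \<open>n \<le> -1\<close>.\<close>

definition P :: "complex \<Rightarrow> int \<Rightarrow> complex" where
  "P z n = (if n \<ge> 0 then pochhammer z (nat n) else 1 / pochhammer (z + of_int n) (nat (- n)))"

end

theory Submission
  imports Defs
begin

text \<open>
  In the divided basis \<open>u\<^sub>n = w\<^sub>n / n!\<close>, with \<open>u\<^sub>n = 0\<close> for \<open>n < 0\<close>, the asserted structure is
  \<open>L\<^sub>i u\<^sub>n = (n - i - (i + 1) \<lambda>/2) u\<^bsub>n - i\<^esub>\<close>, the action of vector fields on tensor densities.
  For \<open>i \<ge> -1\<close> this formula holds for all integers \<open>n\<close>: the truncation at negative indices is
  harmless, because the only operator that could lead from a negative index to a nonnegative one
  is \<open>L\<^bsub>-1\<^esub>\<close> at \<open>n = -1\<close>, whose coefficient \<open>n + 1\<close> vanishes there. Hence the bracket relations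
  reduce to a polynomial identity in \<open>n\<close>, \<open>i\<close>, \<open>j\<close>, with no case distinction on \<open>n\<close>, and the
  structure exists.

  For uniqueness, \<open>w\<^bsub>j + 1\<^esub> = L\<^bsub>-1\<^esub> w\<^sub>j\<close> and \<open>[L\<^sub>i, L\<^bsub>-1\<^esub>] = (i + 1) L\<^bsub>i - 1\<^esub>\<close> express
  \<open>L\<^sub>i w\<^bsub>j + 1\<^esub>\<close> through \<open>L\<^sub>i w\<^sub>j\<close> and \<open>L\<^bsub>i - 1\<^esub> w\<^sub>j\<close>, so by a double induction everything is
  determined by the operators \<open>L\<^bsub>-1\<^esub>\<close> and \<open>L\<^sub>0\<close>, which come from \<open>sl(2)\<close>, and the vectors
  \<open>L\<^sub>i w\<^sub>0\<close> with \<open>i > 0\<close>. The latter vanish, since \<open>L\<^sub>i\<close> would raise the weight of the highest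
  weight vector (\<open>L_w0_eq_0\<close>). The explicit formula therefore need only be read off from the
  constructed structure, and \<open>w\<^sub>0\<close> generates because \<open>L\<^bsub>-1\<^esub>\<close> moves it to every \<open>w\<^sub>j\<close>.
\<close>

lemma witt_induct [case_names L add]:
  assumes L: "\<And>a k. k \<ge> -1 \<Longrightarrow> Q (witt_scale a (L k))"
    and add: "\<And>x y. Q x \<Longrightarrow> Q y \<Longrightarrow> Q (x + y)"
  shows "Q x"
proof -
  have "Q x" if "finite A" "Poly_Mapping.keys (Rep_witt x) \<subseteq> A" for A x
    using that
  proof (induction A arbitrary: x rule: finite_induct)
    case empty
    then have "x = witt_scale 0 (L 0)"
      by (auto simp: Rep_witt_inject[symmetric] witt_scale.rep_eq)
    then show ?case using L[of 0 0] by simp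
  next
    case (insert k A)
    show ?case
    proof (cases "k \<in> Poly_Mapping.keys (Rep_witt x)")
      case True
      then have k: "k \<ge> -1" using Rep_witt[of x] by auto
      let ?z = "witt_scale (Poly_Mapping.lookup (Rep_witt x) k) (L k)"
      have "Poly_Mapping.keys (Rep_witt (x - ?z)) \<subseteq> A"
        using insert.prems k
        by (auto simp: in_keys_iff minus_witt.rep_eq witt_scale.rep_eq L.rep_eq lookup_minus
            lookup_single when_def split: if_splits)
      then have "Q (x - ?z)" by (rule insert.IH)
      from add[OF this L[OF k, of "Poly_Mapping.lookup (Rep_witt x) k"]] show ?thesis by (simp only: diff_add_cancel)
    next
      case False
      then show ?thesis using insert by blast
    qed
  qed
  then show ?thesis by (metis finite_keys order_refl)
qed


section \<open>Existence: the density module\<close>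

text \<open>Indexing by integers, with \<open>0\<close> below the range, lets shifts be written without cases.\<close>

definition divided_basis :: "int \<Rightarrow> verma" where
  "divided_basis n = (if n \<ge> 0 then fscale (1 / fact (nat n)) (w (nat n)) else 0)"

text \<open>The factor \<open>j!\<close> converts \<open>w\<^sub>j\<close> to the divided basis.\<close>

definition density_op :: "complex \<Rightarrow> int \<Rightarrow> verma \<Rightarrow> verma" where
  "density_op lam i = lin_ext (\<lambda>j. fscale ((of_int (int j - i) - of_int (i + 1) * (lam / 2)) * fact j)
     (divided_basis (int j - i)))"

definition density_action :: "complex \<Rightarrow> witt \<Rightarrow> verma \<Rightarrow> verma" where
  "density_action lam x v = lin_ext (\<lambda>i. density_op lam i v) (Rep_witt x)"

lemma density_op_divided_basis:
  assumes "i \<ge> -1"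
  shows "density_op lam i (divided_basis n) =
    fscale (of_int (n - i) - of_int (i + 1) * (lam / 2)) (divided_basis (n - i))"
proof (cases "n \<ge> 0")
  case True
  then show ?thesis
    by (simp add: density_op_def divided_basis_def[of n] w_def lin_ext_fscale del: single_one)
next
  case False
  \<comment> \<open>Only \<open>i = n = -1\<close> reaches the index \<open>0\<close>, and there the coefficient is \<open>n + 1 = 0\<close>.\<close>
  then consider "n - i < 0" | "n - i = 0" "i = -1" using assms by linarith
  then show ?thesis
    using False by cases (simp_all add: divided_basis_def density_op_def)
qed

lemma divided_basis_induct [case_names basis add]:
  assumes "\<And>a n. Q (fscale a (divided_basis n))" "\<And>x y. Q x \<Longrightarrow> Q y \<Longrightarrow> Q (x + y)"
  shows "Q v"
proof (induction v rule: free_induct)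
  case (single j a)
  have "Poly_Mapping.single j a = fscale (a * fact j) (divided_basis (int j))"
    by (simp add: divided_basis_def w_def del: single_one)
  then show ?case using assms(1) by metis
qed (rule assms(2))

lemma density_op_linear:
  "density_op lam i (v + v') = density_op lam i v + density_op lam i v'"
  "density_op lam i (fscale c v) = fscale c (density_op lam i v)"
  by (simp_all add: density_op_def lin_ext_add lin_ext_fscale)

text \<open>On the divided basis this is the identity
  \<open>(m - j - (j+1) \<mu>) (m - i - j - (i+1) \<mu>) - (m - i - (i+1) \<mu>) (m - i - j - (j+1) \<mu>)
    = (i - j) (m - i - j - (i+j+1) \<mu>)\<close> with \<open>\<mu> = \<lambda>/2\<close>. If \<open>i = j = -1\<close>, the index \<open>i + j\<close> lies
  outside the algebra, but then the factor \<open>i - j\<close> vanishes.\<close>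

lemma density_op_commutator:
  assumes "i \<ge> -1" "j \<ge> -1"
  shows "density_op lam i (density_op lam j v) - density_op lam j (density_op lam i v) =
    fscale (of_int (i - j)) (density_op lam (i + j) v)"
proof (induction v rule: divided_basis_induct)
  case (basis a n)
  show ?case
  proof (cases "i + j \<ge> -1")
    case True
    have shift: "n - j - i = n - (i + j)" "n - i - j = n - (i + j)" by simp_all
    show ?thesis using assms True
      by (simp add: density_op_linear density_op_divided_basis shift del: of_int_diff of_int_add)
        (rule poly_mapping_eqI, simp add: lookup_minus field_simps)
  next
    case False
    then have "i = j" using assms by linarith
    then show ?thesis by simp
  qed
next
  case (add x y)
  from arg_cong2[OF add, of "(+)"] show ?case
    by (simp add: density_op_linear fscale_add algebra_simps)
qed

lemma density_action_linear:
  "density_action lam (x + y) v = density_action lam x v + density_action lam y v"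
  "density_action lam (witt_scale c x) v = fscale c (density_action lam x v)"
  "density_action lam x (v + v') = density_action lam x v + density_action lam x v'"
  "density_action lam x (fscale c v) = fscale c (density_action lam x v)"
proof -
  show "density_action lam x (v + v') = density_action lam x v + density_action lam x v'"
    by (simp add: density_action_def density_op_linear lin_ext_def fscale_add sum.distrib)
  interpret vector_space fscale by (rule vector_space_fscale)
  show "density_action lam x (fscale c v) = fscale c (density_action lam x v)"
    by (simp add: density_action_def density_op_linear lin_ext_def scale_sum_right mult.commute)
qed (simp_all add: density_action_def plus_witt.rep_eq witt_scale.rep_eq lin_ext_add lin_ext_fscale)

lemma density_action_L:
  assumes "i \<ge> -1"
  shows "density_action lam (L i) v = density_op lam i v"
  using assms by (simp add: density_action_def L.rep_eq del: single_one)

lemma density_action_bracket: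
  "density_action lam (witt_bracket x y) v =
     density_action lam x (density_action lam y v) - density_action lam y (density_action lam x v)"
proof -
  interpret W: lie_algebra witt_scale witt_bracket by (rule witt_lie_algebra)
  show ?thesis
  proof (induction x rule: witt_induct)
    case (L a i)
    show ?case
    proof (induction y rule: witt_induct)
      case (L b j)
      note i = \<open>i \<ge> -1\<close> and j = \<open>j \<ge> -1\<close>
      have "density_action lam (witt_bracket (L i) (L j)) v =
          fscale (of_int (i - j)) (density_op lam (i + j) v)"
      proof (cases "i + j \<ge> -1")
        case True
        then show ?thesis
          by (simp add: witt_bracket_L i j density_action_linear density_action_L)
      next
        case False
        then have "i = j" using i j by linarith
        then show ?thesis by (simp add: W.bracket_self density_action_def zero_witt.rep_eq)
      qed
      also have "\<dots> = density_op lam i (density_op lam j v) - density_op lam j (density_op lam i v)"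
        using density_op_commutator[OF i j] by simp
      finally have "density_action lam (witt_bracket (L i) (L j)) v =
        density_op lam i (density_op lam j v) - density_op lam j (density_op lam i v)" .
      then show ?case
        by (simp add: W.bracket_scale_left W.bracket_scale_right density_action_linear
            density_action_L i j density_op_linear)
          (rule poly_mapping_eqI, simp add: lookup_minus algebra_simps)
    next
      case (add y z)
      from arg_cong2[OF add, of "(+)"] show ?case
        by (simp add: W.bracket_add_right density_action_linear fscale_add)
    qed
  next
    case (add x z)
    from arg_cong2[OF add, of "(+)"] show ?case
      by (simp add: W.bracket_add_left density_action_linear)
  qed
qed

lemma density_action_module: "witt_module fscale (density_action lam)"
  by (intro lie_module.intro lie_module_axioms.intro witt_lie_algebra vector_space_fscale
      density_action_linear density_action_bracket)

lemma density_op_sl2: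
  "density_op lam (-1) = verma_f"
  "fscale (-2) (density_op lam 0 v) = verma_h lam v"
  "fscale (-1) (density_op lam 1 v) = verma_e lam v"
proof -
  show "density_op lam (-1) = verma_f"
    unfolding density_op_def verma_f_def
  proof (rule arg_cong[of _ _ lin_ext], rule ext)
    fix j
    have "fact (nat (int j + 1)) = (of_nat j + 1) * (fact j :: complex)"
      by (simp add: nat_add_distrib)
    moreover have "1 + of_nat j \<noteq> (0 :: complex)"
      by (metis of_nat_Suc of_nat_neq_0)
    ultimately show "fscale ((of_int (int j - - 1) - of_int (- 1 + 1) * (lam / 2)) * fact j)
        (divided_basis (int j - - 1)) = w (j + 1)"
      by (simp add: divided_basis_def nat_add_distrib add.commute)
  qed
  show "fscale (-2) (density_op lam 0 v) = verma_h lam v"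
    unfolding density_op_def verma_h_def
    by (induction v rule: free_induct)
      (simp_all add: lin_ext_add fscale_add divided_basis_def algebra_simps)
  show "fscale (-1) (density_op lam 1 v) = verma_e lam v"
    unfolding density_op_def verma_e_def
  proof (induction v rule: free_induct)
    case (single j a)
    show ?case
      by (cases j) (simp_all add: divided_basis_def algebra_simps)
  qed (simp add: lin_ext_add fscale_add)
qed

lemma density_action_compatible:
  "compatible_witt_module fscale (verma_action lam) (density_action lam)"
proof -
  interpret W: lie_algebra witt_scale witt_bracket by (rule witt_lie_algebra)
  have "density_action lam (- L 1) v = verma_e lam v" for v
    using density_action_linear(2)[of lam "-1" "L 1" v] density_op_sl2(3)[of lam v]
    by (simp add: density_action_L)
  moreover have "density_action lam (witt_scale (-2) (L 0)) v = verma_h lam v" for v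
    unfolding density_action_linear(2) density_op_sl2(2)[symmetric] by (simp add: density_action_L)
  moreover have "density_action lam (L (-1)) v = verma_f v" for v
    by (simp add: density_action_L density_op_sl2)
  ultimately have "density_action lam (sl2_to_witt x) v = verma_action lam x v" for x v
    unfolding sl2_to_witt_def verma_action_def by (simp only: density_action_linear)
  then show ?thesis
    by (simp add: compatible_witt_module_def density_action_module)
qed

text \<open>For \<open>i = -1\<close> the negative branch of the Pochhammer symbol gives \<open>1 / (j + 1)\<close>, in
  accordance with the quotient of factorials.\<close>

lemma P_eq_fact_quotient:
  assumes "i \<ge> -1" "int j - i \<ge> 0"
  shows "P (of_int (int j - i + 1)) i = fact j / fact (nat (int j - i))"
proof (cases "i \<ge> 0")
  case True
  define m where "m = nat (int j - i)"
  have i: "i = int (nat i)" and j: "j = m + nat i" using True assms by (auto simp: m_def)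
  have "fact j = fact m * pochhammer (1 + of_nat m :: complex) (nat i)"
    unfolding j pochhammer_fact by (rule pochhammer_product')
  moreover have "of_int (int j - i + 1) = (1 + of_nat m :: complex)"
    using assms by (simp add: m_def)
  ultimately show ?thesis
    using True by (simp only: P_def m_def[symmetric] if_True) simp
next
  case False
  then have i: "i = -1" using assms by simp
  have "fact (nat (int j + 1)) = (of_nat j + 1) * (fact j :: complex)"
    by (simp add: nat_add_distrib)
  then show ?thesis by (simp add: i P_def)
qed

lemma density_action_w:
  assumes "i \<ge> -1"
  shows "density_action lam (L i) (w j) =
    (if int j - i \<ge> 0
     then fscale (- (1/2) * (2 * of_int (i - int j) + of_int (i + 1) * lam)
                    * P (of_int (int j - i + 1)) i)
            (w (nat (int j - i)))
     else 0)"
proof -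
  have w: "density_action lam (L i) (w j) =
      fscale ((of_int (int j - i) - of_int (i + 1) * (lam / 2)) * fact j) (divided_basis (int j - i))"
    unfolding density_action_L[OF assms] by (simp add: density_op_def w_def del: single_one)
  show ?thesis
  proof (cases "int j - i \<ge> 0")
    case True
    show ?thesis
      unfolding w P_eq_fact_quotient[OF assms True] using True
      by (simp add: divided_basis_def) (rule arg_cong2[of _ _ _ _ fscale], simp_all add: field_simps)
  next
    case False
    then show ?thesis unfolding w by (simp add: divided_basis_def)
  qed
qed


section \<open>Uniqueness\<close>

lemma compatible_sl2:
  assumes "compatible_witt_module fscale (verma_action lam) \<rho>"
  shows "\<rho> (L (-1)) v = verma_f v" "\<rho> (L 0) v = fscale (- (1/2)) (verma_h lam v)"
proof -
  interpret lie_module witt_scale witt_bracket fscale \<rho>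
    using assms by (simp add: compatible_witt_module_def)
  have \<rho>: "\<rho> (sl2_to_witt x) v = verma_action lam x v" for x
    using assms by (simp add: compatible_witt_module_def)
  show "\<rho> (L (-1)) v = verma_f v"
    using \<rho>[of sl2_f] by (simp add: sl2_to_witt_chevalley verma_action_def sl2_entry.rep_eq
      sl2_f.rep_eq)
  have "fscale (-2) (\<rho> (L 0) v) = verma_h lam v"
    using \<rho>[of sl2_h] unfolding sl2_to_witt_chevalley act_scale_left
    by (simp add: verma_action_def sl2_entry.rep_eq sl2_h.rep_eq)
  then have "fscale (- (1/2)) (verma_h lam v) = fscale (- (1/2)) (fscale (-2) (\<rho> (L 0) v))"
    by simp
  then show "\<rho> (L 0) v = fscale (- (1/2)) (verma_h lam v)" by simp
qed

lemma lookup_verma_h: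
  "Poly_Mapping.lookup (verma_h lam v) k = (lam - 2 * of_nat k) * Poly_Mapping.lookup v k"
proof (induction v rule: free_induct)
  case (single j a)
  show ?case
    by (simp add: verma_h_def w_def lookup_single when_def del: single_one)
next
  case (add x y)
  then show ?case by (simp add: verma_h_def lin_ext_add lookup_add algebra_simps)
qed

text \<open>The commutator with \<open>L\<^sub>0\<close> makes \<open>L\<^sub>i w\<^sub>0\<close> a vector of \<open>h\<close>-weight \<open>\<lambda> + 2 i\<close>, whereas all weights
  of the Verma module have the form \<open>\<lambda> - 2 k\<close> with \<open>k \<ge> 0\<close>.\<close>

lemma L_w0_eq_0:
  assumes comp: "compatible_witt_module fscale (verma_action lam) \<rho>" and i: "i > 0"
  shows "\<rho> (L i) (w 0) = 0"
proof -
  interpret lie_module witt_scale witt_bracket fscale \<rho>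
    using comp by (simp add: compatible_witt_module_def)
  let ?y = "\<rho> (L i) (w 0)"
  have "verma_h lam (w 0) = fscale lam (w 0)"
    by (simp add: verma_h_def w_def del: single_one)
  then have w0: "\<rho> (L 0) (w 0) = fscale (- (lam / 2)) (w 0)"
    by (simp add: compatible_sl2[OF comp])
  have "witt_bracket (L 0) (L i) = witt_scale (of_int (- i)) (L i)"
    using witt_bracket_L[of 0 i] i by simp
  then have "fscale (of_int (- i)) ?y = \<rho> (L 0) ?y - \<rho> (L i) (\<rho> (L 0) (w 0))"
    using act_bracket[of "L 0" "L i" "w 0"] by (simp only: act_scale_left)
  then have eq: "fscale (of_int (- i)) ?y = fscale (- (1/2)) (verma_h lam ?y) - fscale (- (lam / 2)) ?y"
    by (simp only: w0 act_scale_right compatible_sl2(2)[OF comp, of ?y])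
  show ?thesis
  proof (rule poly_mapping_eqI)
    fix k
    have "of_int (- i) * Poly_Mapping.lookup ?y k =
      - (1/2) * ((lam - 2 * of_nat k) * Poly_Mapping.lookup ?y k) + lam / 2 * Poly_Mapping.lookup ?y k"
      using arg_cong[OF eq, of "\<lambda>z. Poly_Mapping.lookup z k"]
      by (simp add: lookup_minus lookup_verma_h)
    then have "of_int (i + int k) * Poly_Mapping.lookup ?y k = 0"
      by (simp add: field_simps add_eq_0_iff)
    moreover have "of_int (i + int k) \<noteq> (0 :: complex)"
      using i by (subst of_int_eq_0_iff) linarith
    ultimately show "Poly_Mapping.lookup ?y k = Poly_Mapping.lookup 0 k"
      by simp
  qed
qed

lemma compatible_recursion:
  assumes comp: "compatible_witt_module fscale (verma_action lam) \<rho>" and i: "i \<ge> 0"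
  shows "\<rho> (L i) (w (Suc j)) =
    verma_f (\<rho> (L i) (w j)) + fscale (of_int (i + 1)) (\<rho> (L (i - 1)) (w j))"
proof -
  interpret lie_module witt_scale witt_bracket fscale \<rho>
    using comp by (simp add: compatible_witt_module_def)
  have "witt_bracket (L i) (L (-1)) = witt_scale (of_int (i + 1)) (L (i - 1))"
    using witt_bracket_L[of i "-1"] i by simp
  then have "fscale (of_int (i + 1)) (\<rho> (L (i - 1)) (w j)) =
      \<rho> (L i) (verma_f (w j)) - verma_f (\<rho> (L i) (w j))"
    using act_bracket[of "L i" "L (-1)" "w j"]
    by (simp only: act_scale_left compatible_sl2[OF comp])
  moreover have "verma_f (w j) = w (Suc j)"
    by (simp add: verma_f_def w_def del: single_one)
  ultimately show ?thesis by simp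
qed

lemma compatible_agree_on_basis:
  assumes comp: "compatible_witt_module fscale (verma_action lam) \<rho>"
    "compatible_witt_module fscale (verma_action lam) \<rho>'"
    and "i \<ge> -1"
  shows "\<rho> (L i) (w j) = \<rho>' (L i) (w j)"
  using assms(3)
proof (induction i arbitrary: j rule: int_ge_induct)
  case base
  show ?case by (simp add: comp[THEN compatible_sl2(1)])
next
  case (step i)
  show ?case
  proof (induction j)
    case 0
    show ?case
    proof (cases "i + 1 = 0")
      case True
      then show ?thesis by (simp add: comp[THEN compatible_sl2(2)])
    next
      case False
      then have "i + 1 > 0" using step by linarith
      then show ?thesis by (simp add: comp[THEN L_w0_eq_0])
    qed
  next
    case (Suc j)
    have "i + 1 \<ge> 0" using step by linarith
    then show ?case
      using Suc step.IH[of j] by (simp add: comp[THEN compatible_recursion])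
  qed
qed

lemma compatible_unique:
  assumes comp: "compatible_witt_module fscale (verma_action lam) \<rho>"
    "compatible_witt_module fscale (verma_action lam) \<rho>'"
  shows "\<rho> = \<rho>'"
proof (intro ext)
  fix x v
  interpret A: lie_module witt_scale witt_bracket fscale \<rho>
    using comp by (simp add: compatible_witt_module_def)
  interpret B: lie_module witt_scale witt_bracket fscale \<rho>'
    using comp by (simp add: compatible_witt_module_def)
  show "\<rho> x v = \<rho>' x v"
  proof (induction x rule: witt_induct)
    case (L a k)
    show ?case
    proof (induction v rule: free_induct)
      case (single j b)
      have "Poly_Mapping.single j b = fscale b (w j)"
        by (simp add: w_def del: single_one)
      then show ?case
        using compatible_agree_on_basis[OF comp L]
        by (simp add: A.act_scale_left B.act_scale_left A.act_scale_right B.act_scale_right)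
    next
      case (add v v')
      then show ?case by (simp add: A.act_add_right B.act_add_right)
    qed
  next
    case (add x y)
    then show ?case by (simp add: A.act_add_left B.act_add_left)
  qed
qed


section \<open>The highest weight vector\<close>

lemma compatible_highest_weight:
  assumes comp: "compatible_witt_module fscale (verma_action lam) \<rho>"
  shows "highest_weight_witt_module fscale \<rho> (- (1/2) * lam)"
proof -
  interpret lie_module witt_scale witt_bracket fscale \<rho>
    using comp by (simp add: compatible_witt_module_def)
  have "v \<in> U" if U: "submodule U" "w 0 \<in> U" for U v
  proof -
    have w: "w j \<in> U" for j
    proof (induction j)
      case (Suc j)
      have "\<rho> (L (-1)) (w j) \<in> U" using U Suc by (simp add: submodule_def)
      moreover have "\<rho> (L (-1)) (w j) = w (Suc j)"
        unfolding compatible_sl2[OF comp] by (simp add: verma_f_def w_def del: single_one)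
      ultimately show ?case by simp
    qed (rule U)
    have sub: "V.subspace U" using U by (simp add: submodule_def)
    show ?thesis
    proof (induction v rule: free_induct)
      case (single j a)
      have "fscale a (w j) \<in> U" using sub w by (rule V.subspace_scale)
      then show ?case by (simp add: w_def del: single_one)
    next
      case (add x y)
      then show ?case using sub by (simp add: V.subspace_add)
    qed
  qed
  then have "generated_submodule {w 0} = UNIV"
    by (auto simp: generated_submodule_def)
  moreover have "w 0 \<noteq> 0"
    unfolding w_def by (metis lookup_single_eq lookup_zero zero_neq_one)
  moreover have "\<rho> (L 0) (w 0) = fscale (- (1/2) * lam) (w 0)"
    unfolding compatible_sl2[OF comp] by (simp add: verma_h_def w_def del: single_one)
  ultimately show ?thesis
    unfolding highest_weight_witt_module_def
    using L_w0_eq_0[OF comp] lie_module_axioms by blast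
qed


section \<open>Classification of the compatible structures\<close>

theorem proposition4p12:
  fixes lam :: complex
  shows "(\<exists>!\<rho>. compatible_witt_module fscale (verma_action lam) \<rho>) \<and>
    (\<forall>\<rho>. compatible_witt_module fscale (verma_action lam) \<rho> \<longrightarrow>
      (\<forall>(i::int) (j::nat). i \<ge> -1 \<longrightarrow>
        \<rho> (L i) (w j) =
          (if int j - i \<ge> 0
           then fscale (- (1/2) * (2 * of_int (i - int j) + of_int (i + 1) * lam)
                          * P (of_int (int j - i + 1)) i)
                  (w (nat (int j - i)))
           else 0)) \<and>
      highest_weight_witt_module fscale \<rho> (- (1/2) * lam))"
proof (intro conjI allI impI)
  show "\<exists>!\<rho>. compatible_witt_module fscale (verma_action lam) \<rho>"
  proof (rule ex1I)
    show "compatible_witt_module fscale (verma_action lam) (density_action lam)"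
      by (rule density_action_compatible)
  next
    fix \<rho>
    assume "compatible_witt_module fscale (verma_action lam) \<rho>"
    then show "\<rho> = density_action lam"
      using density_action_compatible by (rule compatible_unique)
  qed
next
  fix \<rho> and i :: int and j :: nat
  assume "compatible_witt_module fscale (verma_action lam) \<rho>" and i: "i \<ge> -1"
  from this(1) have "\<rho> = density_action lam"
    using density_action_compatible by (rule compatible_unique)
  then show "\<rho> (L i) (w j) =
      (if int j - i \<ge> 0
       then fscale (- (1/2) * (2 * of_int (i - int j) + of_int (i + 1) * lam)
                      * P (of_int (int j - i + 1)) i)
              (w (nat (int j - i)))
       else 0)"
    using density_action_w[OF i] by simp
next
  fix \<rho>
  assume "compatible_witt_module fscale (verma_action lam) \<rho>"
  then show "highest_weight_witt_module fscale \<rho> (- (1/2) * lam)"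
    by (rule compatible_highest_weight)
qed

end
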